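(* Let $\mathcal{F}$ be any $\mathbf{\Pi}^0_2$ partition regular family of subsets of $\mathbb{N}$. For almost every graph on $\mathbb{N}$, there is some $A \in \mathcal{F}$ such that every connected component of the induced subgraph on $A$ is finite. In particular, not every set in $\mathcal{F}$ is universal.
   Context: $\mathbb{N}=\{1,2,3,\dots\}$. A random graph on $\mathbb{N}$ is formed by including each pair $\{m,n\}$ ($m\neq n$) as an edge independently with probability $\tfrac12$; "almost every graph on $\mathbb{N}$ has property $P$" means that this random graph has property $P$ with probability $1$. For a fixed graph on $\mathbb{N}$, $A\subseteq\mathbb{N}$ is universal if the induced subgraph on $A$ contains every countable graph as an induced subgraph. A (Furstenberg) family is a nonempty collection $\mathcal{F}$ of subsets of $\mathbb{N}$ closed under supersets; it is partition regular if whenever $A\in\mathcal{F}$ and $A=A_1\cup\dots\cup A_n$, some $A_i\in\mathcal{F}$. The power set $\mathcal{P}(\mathbb{N})$ carries the topology (identified with Cantor space $2^{\mathbb{N}}$) whose basic open sets are $\langle F,n\rangle=\{A\subseteq\mathbb{N}: A\cap[1,n]=F\}$ for $n\in\mathbb{N}$ and $F\subseteq[1,n]$. A family is $\mathbf{\Pi}^0_2$ if it is a countable intersection of open subsets of $\mathcal{P}(\mathbb{N})$ in this topology. *)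

theory Defs
  imports "HOL-Probability.Probability"
begin

abbreviation Npos :: "nat set" where
  "Npos \<equiv> {1..}"

section \<open>Simple graphs\<close>

text \<open>A graph is a pair of a vertex set and a set of edges, an edge being a two-element
  set of vertices.\<close>

type_synonym 'a ugraph = "'a set \<times> 'a set set"

abbreviation verts :: "'a ugraph \<Rightarrow> 'a set" where
  "verts G \<equiv> fst G"

abbreviation edges :: "'a ugraph \<Rightarrow> 'a set set" where
  "edges G \<equiv> snd G"

definition pairs :: "'a set \<Rightarrow> 'a set set" where
  "pairs V = {e. e \<subseteq> V \<and> card e = 2}"

definition simple_graph :: "'a ugraph \<Rightarrow> bool" where
  "simple_graph G \<longleftrightarrow> edges G \<subseteq> pairs (verts G)"

definition induced :: "'a ugraph \<Rightarrow> 'a set \<Rightarrow> 'a ugraph" where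
  "induced G A = (verts G \<inter> A, {e \<in> edges G. e \<subseteq> A})"

definition connected_component_of_vertex :: "'a ugraph \<Rightarrow> 'a \<Rightarrow> 'a set" where
  "connected_component_of_vertex G v = {w \<in> verts G. (v, w) \<in> {(x, y). {x, y} \<in> edges G}\<^sup>*}"

definition connected_components :: "'a ugraph \<Rightarrow> 'a set set" where
  "connected_components G = connected_component_of_vertex G ` verts G"

definition isomorphic :: "'a ugraph \<Rightarrow> 'b ugraph \<Rightarrow> bool" where
  "isomorphic G H \<longleftrightarrow>
     (\<exists>f. bij_betw f (verts G) (verts H) \<and>
          (\<forall>x\<in>verts G. \<forall>y\<in>verts G. {x, y} \<in> edges G \<longleftrightarrow> {f x, f y} \<in> edges H))"

definition contains_induced :: "'a ugraph \<Rightarrow> 'b ugraph \<Rightarrow> bool" where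
  "contains_induced G H \<longleftrightarrow> (\<exists>S\<subseteq>verts G. isomorphic H (induced G S))"

text \<open>Every countable graph, finite or infinite, is isomorphic to one whose vertex set is
  a set of natural numbers, so it is enough to let \<open>H\<close> range over the latter.\<close>

definition universal :: "nat ugraph \<Rightarrow> nat set \<Rightarrow> bool" where
  "universal G A \<longleftrightarrow> A \<subseteq> Npos \<and>
     (\<forall>H :: nat ugraph. simple_graph H \<longrightarrow> contains_induced (induced G A) H)"

section \<open>The random graph\<close>

definition edge_coins :: "(nat set \<Rightarrow> bool) measure" where
  "edge_coins = PiM (pairs Npos) (\<lambda>_. measure_pmf (bernoulli_pmf (1/2)))"

definition coin_graph :: "(nat set \<Rightarrow> bool) \<Rightarrow> nat ugraph" where
  "coin_graph \<omega> = (Npos, {e \<in> pairs Npos. \<omega> e})"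

definition almost_every_graph :: "(nat ugraph \<Rightarrow> bool) \<Rightarrow> bool" where
  "almost_every_graph P \<longleftrightarrow> (AE \<omega> in edge_coins. P (coin_graph \<omega>))"

section \<open>Families of sets\<close>

definition furstenberg_family :: "nat set set \<Rightarrow> bool" where
  "furstenberg_family \<F> \<longleftrightarrow> \<F> \<noteq> {} \<and> \<F> \<subseteq> Pow Npos \<and>
     (\<forall>A\<in>\<F>. \<forall>B. A \<subseteq> B \<and> B \<subseteq> Npos \<longrightarrow> B \<in> \<F>)"

definition partition_regular :: "nat set set \<Rightarrow> bool" where
  "partition_regular \<F> \<longleftrightarrow>
     (\<forall>A\<in>\<F>. \<forall>n\<ge>1. \<forall>P :: nat \<Rightarrow> nat set.
        A = (\<Union>i\<in>{1..n}. P i) \<longrightarrow> (\<exists>i\<in>{1..n}. P i \<in> \<F>))"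

definition basic_open :: "nat set \<Rightarrow> nat \<Rightarrow> nat set set" where
  "basic_open F n = {A. A \<subseteq> Npos \<and> A \<inter> {1..n} = F}"

definition powerset_topology :: "nat set topology" where
  "powerset_topology = topology_generated_by {basic_open F n | F n. n \<ge> 1 \<and> F \<subseteq> {1..n}}"

lemma topspace_powerset_topology: "topspace powerset_topology = Pow Npos"
proof
  show "topspace powerset_topology \<subseteq> Pow Npos"
    unfolding powerset_topology_def topology_generated_by_topspace basic_open_def by blast
next
  show "Pow Npos \<subseteq> topspace powerset_topology"
  proof
    fix A :: "nat set"
    assume "A \<in> Pow Npos"
    then have "A \<in> basic_open (A \<inter> {1..1}) 1"
      unfolding basic_open_def by blast
    moreover have "basic_open (A \<inter> {1..1}) 1 \<in> {basic_open F n | F n. n \<ge> 1 \<and> F \<subseteq> {1..n}}"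
      by blast
    ultimately show "A \<in> topspace powerset_topology"
      unfolding powerset_topology_def topology_generated_by_topspace by (rule UnionI[rotated])
  qed
qed

abbreviation Pi02 :: "nat set set \<Rightarrow> bool" where
  "Pi02 \<F> \<equiv> gdelta_in powerset_topology \<F>"

end

theory Submission
  imports Defs
begin

text \<open>By compactness a \<open>\<Pi>\<^sup>0\<^sub>2\<close> family \<open>\<F>\<close> closed under supersets has the form
  \<open>{A. \<forall>k. \<exists>D\<in>\<S> k. D \<subseteq> A}\<close> with every \<open>\<S> k\<close> consisting of finite sets. If \<open>\<F>\<close> has no
  finite member, fix a finite \<open>X\<close> and split the remaining vertices into \<open>2\<^sup>|\<^sup>X\<^sup>|\<close> classes
  according to their neighbours in \<open>X\<close>. Some class lies in \<open>\<F>\<close>, all classes are equally likely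
  to do so because flipping coins preserves the measure, and each of these events is a tail event.
  So by the zero-one law almost surely the vertices without neighbours in \<open>X\<close> form a member
  of \<open>\<F>\<close>, for all finite \<open>X\<close> simultaneously. One can then greedily choose finite sets
  \<open>D k \<in> \<S> k\<close> with no edges between them; their union is the required \<open>A\<close>. An infinite
  complete graph does not embed into it.\<close>

section \<open>Families of sets\<close>

text \<open>Cylinders around a fixed \<open>B\<close> are nested: the one at level
  \<open>max m n\<close> lies in those at levels \<open>m\<close> and \<open>n\<close>. So the
  generating sets form a base and not only a subbase.\<close>

lemma openin_powerset_topology_basic:
  assumes "openin powerset_topology U" and "B \<in> U"
  obtains n where "basic_open (B \<inter> {1..n}) n \<subseteq> U"
proof -
  let ?\<S> = "{basic_open F n | F n. n \<ge> 1 \<and> F \<subseteq> {1..n}}"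
  have "generate_topology_on ?\<S> U"
    using assms(1) openin_topology_generated_by_iff unfolding powerset_topology_def by blast
  then have "\<forall>B\<in>U. \<exists>n. basic_open (B \<inter> {1..n}) n \<subseteq> U"
  proof induction
    case Empty
    then show ?case by simp
  next
    case (Int a b)
    show ?case
    proof
      fix B assume "B \<in> a \<inter> b"
      then obtain m n where m: "basic_open (B \<inter> {1..m}) m \<subseteq> a"
        and n: "basic_open (B \<inter> {1..n}) n \<subseteq> b"
        using Int.IH by (meson IntD1 IntD2)
      have max: "{1..max m n} \<inter> {1..m} = {1..m}" "{1..max m n} \<inter> {1..n} = {1..n}" by auto
      have "A \<inter> {1..m} = B \<inter> {1..m}" "A \<inter> {1..n} = B \<inter> {1..n}"
        if "A \<inter> {1..max m n} = B \<inter> {1..max m n}" for A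
        using that max by (metis inf_assoc)+
      then have "basic_open (B \<inter> {1..max m n}) (max m n) \<subseteq>
          basic_open (B \<inter> {1..m}) m \<inter> basic_open (B \<inter> {1..n}) n"
        unfolding basic_open_def by blast
      then show "\<exists>n. basic_open (B \<inter> {1..n}) n \<subseteq> a \<inter> b"
        using m n by blast
    qed
  next
    case (UN K)
    then show ?case by (meson Union_iff Union_upper order_trans)
  next
    case (Basis s)
    then show ?case unfolding basic_open_def by blast
  qed
  then show thesis using assms(2) that by blast
qed

text \<open>Compactness of Cantor space, by Koenig's lemma on the tree of finite approximations
  \<open>s \<subseteq> {1..n}\<close> to a superset of \<open>A\<close> outside \<open>U\<close>.\<close>

lemma open_contains_supersets_of_finite:
  assumes U: "openin powerset_topology U"
    and A: "\<And>B. A \<subseteq> B \<Longrightarrow> B \<subseteq> Npos \<Longrightarrow> B \<in> U" and "A \<subseteq> Npos"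
  shows "\<exists>D\<subseteq>A. finite D \<and> (\<forall>B. D \<subseteq> B \<and> B \<subseteq> Npos \<longrightarrow> B \<in> U)"
proof -
  \<comment> \<open>\<open>Q n s\<close> marks the node \<open>s\<close> at level \<open>n\<close>
    as good: a finite part of \<open>A\<close> together with the trace \<open>s\<close> on
    \<open>{1..n}\<close> already forces membership in \<open>U\<close>.\<close>
  define Q where "Q n s \<longleftrightarrow>
    (\<exists>m. \<forall>B\<subseteq>Npos. B \<inter> {1..n} = s \<and> A \<inter> {1..m} \<subseteq> B \<longrightarrow> B \<in> U)" for n :: nat and s
  have "Q 0 {}"
  proof (rule ccontr)
    assume nQ: "\<not> Q 0 {}"
    \<comment> \<open>A bad node has a bad child: if both extensions \<open>s\<close> and
      \<open>insert (Suc n) s\<close> were good with bounds \<open>m\<close> and \<open>m'\<close>,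
      then \<open>max m m'\<close> would make \<open>s\<close> good.\<close>
    have step: "\<exists>t. (t \<subseteq> {1..Suc n} \<and> \<not> Q (Suc n) t) \<and> t \<inter> {1..n} = s"
      if s: "s \<subseteq> {1..n} \<and> \<not> Q n s" for n s
    proof (rule ccontr)
      assume no: "\<not> ?thesis"
      have "Suc n \<notin> s" using s by auto
      have "s \<inter> {1..n} = s" "insert (Suc n) s \<inter> {1..n} = s"
        "s \<subseteq> {1..Suc n}" "insert (Suc n) s \<subseteq> {1..Suc n}"
        using s by auto
      with no have "Q (Suc n) s" "Q (Suc n) (insert (Suc n) s)" by blast+
      then obtain m m' where
        m: "\<And>B. B \<subseteq> Npos \<Longrightarrow> B \<inter> {1..Suc n} = s \<Longrightarrow> A \<inter> {1..m} \<subseteq> B \<Longrightarrow> B \<in> U" and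
        m': "\<And>B. B \<subseteq> Npos \<Longrightarrow> B \<inter> {1..Suc n} = insert (Suc n) s \<Longrightarrow> A \<inter> {1..m'} \<subseteq> B \<Longrightarrow> B \<in> U"
        unfolding Q_def by metis
      have "B \<in> U" if B: "B \<subseteq> Npos" "B \<inter> {1..n} = s" "A \<inter> {1..max m m'} \<subseteq> B" for B
      proof -
        have sub: "A \<inter> {1..m} \<subseteq> B" "A \<inter> {1..m'} \<subseteq> B"
          using B(3) by (auto simp: subset_iff)
        have Suc: "{1..Suc n} = insert (Suc n) {1..n}" by auto
        show ?thesis
        proof (cases "Suc n \<in> B")
          case True
          then have "B \<inter> {1..Suc n} = insert (Suc n) s" using B(2) Suc by auto
          then show ?thesis using m' B(1) sub(2) by blast
        next
          case False
          then have "B \<inter> {1..Suc n} = s" using B(2) Suc by auto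
          then show ?thesis using m B(1) sub(1) by blast
        qed
      qed
      then have "Q n s" unfolding Q_def by blast
      then show False using s by blast
    qed
    have "\<exists>f. \<forall>n. (f n \<subseteq> {1..n} \<and> \<not> Q n (f n)) \<and> f (Suc n) \<inter> {1..n} = f n"
      by (rule dependent_nat_choice) (use nQ step in auto)
    then obtain f where f: "\<And>n. f n \<subseteq> {1..n}" "\<And>n. \<not> Q n (f n)"
      "\<And>n. f (Suc n) \<inter> {1..n} = f n"
      by blast
    have f_mono: "f (n + k) \<inter> {1..n} = f n" for n k
    proof (induction k)
      case 0
      then show ?case using f(1)[of n] by auto
    next
      case (Suc k)
      have "f (n + Suc k) \<inter> {1..n} = (f (Suc (n + k)) \<inter> {1..n + k}) \<inter> {1..n}" by auto
      then show ?case using f(3)[of "n + k"] Suc by simp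
    qed
    define B where "B = (\<Union>n. f n)"
    have B_n: "B \<inter> {1..n} = f n" for n
    proof
      show "f n \<subseteq> B \<inter> {1..n}" using f(1) by (auto simp: B_def)
      show "B \<inter> {1..n} \<subseteq> f n"
      proof
        fix y assume "y \<in> B \<inter> {1..n}"
        then obtain m where m: "y \<in> f m" and y: "y \<in> {1..n}" by (auto simp: B_def)
        show "y \<in> f n"
        proof (cases "n \<le> m")
          case True
          then have "f m \<inter> {1..n} = f n" using f_mono[of n "m - n"] by simp
          then show ?thesis using m y by blast
        next
          case False
          then have "f n \<inter> {1..m} = f m" using f_mono[of m "n - m"] by simp
          then show ?thesis using m by blast
        qed
      qed
    qed
    have "B \<subseteq> Npos" using f(1) by (fastforce simp: B_def)
    \<comment> \<open>Badness of \<open>f a\<close>, read at the bound \<open>m = a\<close>,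
      supplies a set with trace \<open>f a\<close> that contains \<open>A \<inter> {1..a}\<close>;
      hence \<open>a \<in> f a\<close>.\<close>
    have "A \<subseteq> B"
    proof
      fix a assume "a \<in> A"
      obtain B' where "B' \<inter> {1..a} = f a" "A \<inter> {1..a} \<subseteq> B'"
        using f(2)[of a] unfolding Q_def by blast
      moreover have "a \<in> {1..a}" using \<open>a \<in> A\<close> \<open>A \<subseteq> Npos\<close> by auto
      ultimately have "a \<in> f a" using \<open>a \<in> A\<close> by blast
      then show "a \<in> B" by (auto simp: B_def)
    qed
    then have "B \<in> U" using A \<open>B \<subseteq> Npos\<close> by blast
    then obtain n where "basic_open (B \<inter> {1..n}) n \<subseteq> U"
      using openin_powerset_topology_basic U by blast
    \<comment> \<open>Openness puts a whole cylinder around the branch \<open>B\<close> into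
      \<open>U\<close>, so the node \<open>f n\<close> of the branch would be good.\<close>
    then have "Q n (f n)" unfolding Q_def B_n basic_open_def by blast
    then show False using f(2) by blast
  qed
  \<comment> \<open>At level 0 the trace condition is vacuous because \<open>{1..0}\<close> is
    empty.\<close>
  then obtain m where "\<And>B. B \<subseteq> Npos \<Longrightarrow> A \<inter> {1..m} \<subseteq> B \<Longrightarrow> B \<in> U"
    unfolding Q_def by auto
  then show ?thesis by (intro exI[of _ "A \<inter> {1..m}"]) auto
qed

text \<open>\<open>\<S> k\<close> consists of the finite sets all of whose supersets lie in the
  \<open>k\<close>-th open set. For \<open>A \<in> \<F>\<close> all supersets of \<open>A\<close>
  lie in that open set, so compactness provides a witness inside \<open>A\<close>; the converse
  inclusion is immediate.\<close>

lemma Pi02_furstenberg_finite_witnesses: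
  assumes "furstenberg_family \<F>" and "Pi02 \<F>"
  obtains \<S> :: "nat \<Rightarrow> nat set set" where "\<And>k D. D \<in> \<S> k \<Longrightarrow> finite D"
    and "\<F> = {A \<in> Pow Npos. \<forall>k. \<exists>D\<in>\<S> k. D \<subseteq> A}"
proof -
  have ff: "\<F> \<subseteq> Pow Npos" "\<And>A B. A \<in> \<F> \<Longrightarrow> A \<subseteq> B \<Longrightarrow> B \<subseteq> Npos \<Longrightarrow> B \<in> \<F>"
    using assms(1) unfolding furstenberg_family_def by blast+
  obtain \<U> where \<U>: "countable \<U>" "\<U> \<subseteq> Collect (openin powerset_topology)"
    "Pow Npos \<inter> \<Inter>\<U> = \<F>"
    using assms(2)
    unfolding gdelta_in_def relative_to_def intersection_of_def topspace_powerset_topology by blast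
  \<comment> \<open>Adding the whole space makes the countable family nonempty, so that it can be
    enumerated by the naturals, and keeps its intersection inside \<open>Pow Npos\<close>.\<close>
  define \<V> where "\<V> = insert (Pow Npos) \<U>"
  have "openin powerset_topology (Pow Npos)"
    using openin_topspace topspace_powerset_topology by metis
  then have "\<And>V. V \<in> \<V> \<Longrightarrow> openin powerset_topology V"
    using \<U>(2) unfolding \<V>_def by blast
  moreover have "countable \<V>" "\<V> \<noteq> {}" "\<F> = \<Inter>\<V>" using \<U> by (auto simp: \<V>_def)
  ultimately have \<V>: "countable \<V>" "\<V> \<noteq> {}" "\<And>V. V \<in> \<V> \<Longrightarrow> openin powerset_topology V" "\<F> = \<Inter>\<V>"
    by blast+
  define V where "V = from_nat_into \<V>"
  have V: "range V = \<V>" unfolding V_def using \<V> by (intro range_from_nat_into)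
  define \<S> where "\<S> k = {D. finite D \<and> (\<forall>B. D \<subseteq> B \<and> B \<subseteq> Npos \<longrightarrow> B \<in> V k)}" for k
  have "\<F> = {A \<in> Pow Npos. \<forall>k. \<exists>D\<in>\<S> k. D \<subseteq> A}"
  proof (intro equalityI subsetI)
    fix A assume A: "A \<in> \<F>"
    have "\<exists>D\<in>\<S> k. D \<subseteq> A" for k
    proof -
      have Vk: "openin powerset_topology (V k)" "\<F> \<subseteq> V k" using V \<V>(3,4) by auto
      have "\<exists>D\<subseteq>A. finite D \<and> (\<forall>B. D \<subseteq> B \<and> B \<subseteq> Npos \<longrightarrow> B \<in> V k)"
      proof (rule open_contains_supersets_of_finite[OF Vk(1)])
        show "B \<in> V k" if "A \<subseteq> B" "B \<subseteq> Npos" for B using ff(2)[OF A that] Vk(2) by blast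
        show "A \<subseteq> Npos" using A ff(1) by blast
      qed
      then show ?thesis unfolding \<S>_def by blast
    qed
    then show "A \<in> {A \<in> Pow Npos. \<forall>k. \<exists>D\<in>\<S> k. D \<subseteq> A}" using A ff by blast
  next
    fix A assume "A \<in> {A \<in> Pow Npos. \<forall>k. \<exists>D\<in>\<S> k. D \<subseteq> A}"
    then have "A \<in> V k" for k unfolding \<S>_def by blast
    then show "A \<in> \<F>" using V \<V>(4) by blast
  qed
  moreover have "finite D" if "D \<in> \<S> k" for k D using that by (simp add: \<S>_def)
  ultimately show thesis using that[of \<S>] by blast
qed

section \<open>Consequences of partition regularity\<close>

lemma partition_regular_finite_UN:
  assumes "partition_regular \<F>" and "finite I" "I \<noteq> {}" and "(\<Union>i\<in>I. P i) \<in> \<F>"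
  shows "\<exists>i\<in>I. P i \<in> \<F>"
proof -
  obtain h where h: "bij_betw h {1..card I} I"
    using ex_bij_betw_nat_finite_1[OF assms(2)] by blast
  then have I: "h ` {1..card I} = I" by (simp add: bij_betw_def)
  have "card I \<ge> 1" using assms(2,3) by (simp add: Suc_leI card_gt_0_iff)
  moreover have "(\<Union>i\<in>I. P i) = (\<Union>i\<in>{1..card I}. P (h i))"
    by (metis I image_image)
  ultimately have "\<exists>i\<in>{1..card I}. P (h i) \<in> \<F>"
    using assms(1,4) unfolding partition_regular_def by blast
  then show ?thesis using I by auto
qed

text \<open>Of the two pieces \<open>A \<inter> B\<close> and \<open>A - B\<close>, the first is
  finite and thus excluded. Membership in \<open>\<F>\<close> therefore ignores finite changes,
  which is what later produces tail events.\<close>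

lemma partition_regular_Diff_finite:
  assumes "partition_regular \<F>" and "\<And>A. A \<in> \<F> \<Longrightarrow> infinite A"
    and "A \<in> \<F>" and "finite B"
  shows "A - B \<in> \<F>"
proof -
  have "(\<Union>b\<in>UNIV. if b then A \<inter> B else A - B) = A" by (auto split: if_splits)
  then have "\<exists>b\<in>UNIV. (if b then A \<inter> B else A - B) \<in> \<F>"
    using partition_regular_finite_UN[OF assms(1), of UNIV "\<lambda>b. if b then A \<inter> B else A - B"]
      assms(3) by simp
  then show ?thesis using assms(2)[of "A \<inter> B"] assms(4) by (auto split: if_splits)
qed

section \<open>Induced subgraphs with finite components\<close>

text \<open>In an embedded complete graph on the naturals every vertex is \<open>f 0\<close> or
  adjacent to it, so the component of \<open>f 0\<close> is infinite.\<close>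

lemma finite_component_not_universal:
  assumes "\<forall>C\<in>connected_components (induced G A). finite C"
  shows "\<not> universal G A"
proof
  assume "universal G A"
  moreover have "simple_graph (UNIV :: nat set, pairs UNIV)" by (simp add: simple_graph_def)
  ultimately have "contains_induced (induced G A) (UNIV :: nat set, pairs UNIV)"
    unfolding universal_def by blast
  then obtain S f where S: "S \<subseteq> verts (induced G A)"
    and f: "bij_betw f (UNIV :: nat set) (verts (induced (induced G A) S))"
    and e: "\<And>x y. {x, y} \<in> pairs (UNIV :: nat set) \<longleftrightarrow> {f x, f y} \<in> edges (induced (induced G A) S)"
    unfolding contains_induced_def isomorphic_def by auto
  let ?C = "connected_component_of_vertex (induced G A) (f 0)"
  have f_verts: "f x \<in> verts (induced G A)" for x
    using bij_betwE[OF f] by (auto simp: induced_def)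
  have "f x \<in> ?C" for x
  proof -
    have "(f 0, f x) \<in> {(x, y). {x, y} \<in> edges (induced G A)}\<^sup>*"
    proof (cases "x = 0")
      case False
      then have "{0, x} \<in> pairs UNIV" by (auto simp: pairs_def)
      then have "{f 0, f x} \<in> edges (induced G A)" using e by (auto simp: induced_def)
      then show ?thesis by blast
    qed simp
    then show ?thesis using f_verts by (simp add: connected_component_of_vertex_def)
  qed
  then have "range f \<subseteq> ?C" by blast
  moreover have "infinite (range f)"
    using f range_inj_infinite unfolding bij_betw_def by blast
  ultimately have "infinite ?C" by (rule infinite_super)
  then show False using assms f_verts unfolding connected_components_def by blast
qed

text \<open>Induction along a path: an edge leaving a vertex of \<open>D k\<close> ends in some
  \<open>D j\<close>, and \<open>j \<noteq> k\<close> would make it a cross edge. So each component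
  stays within one finite block.\<close>

lemma finite_components_if_no_cross_edges:
  fixes D :: "nat \<Rightarrow> nat set"
  assumes fin: "\<And>k. finite (D k)"
    and no_edge: "\<And>j k x y. j < k \<Longrightarrow> x \<in> D j \<Longrightarrow> y \<in> D k \<Longrightarrow> {x, y} \<notin> edges G"
    and disj: "\<And>j k. j < k \<Longrightarrow> D j \<inter> D k = {}"
    and C: "C \<in> connected_components (induced G (\<Union>k. D k))"
  shows "finite C"
proof -
  let ?A = "\<Union>k. D k"
  obtain v where v: "v \<in> ?A" and C: "C = connected_component_of_vertex (induced G ?A) v"
    using C by (auto simp: connected_components_def induced_def)
  obtain k where k: "v \<in> D k" using v by blast
  have "w \<in> D k" if "(v, w) \<in> {(x, y). {x, y} \<in> edges (induced G ?A)}\<^sup>*" for w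
    using that
  proof induction
    case base
    then show ?case by (fact k)
  next
    case (step y z)
    then have yz: "{y, z} \<in> edges G" and "z \<in> ?A" by (auto simp: induced_def)
    then obtain j where j: "z \<in> D j" by blast
    have "j = k"
    proof (rule linorder_cases[of j k])
      assume "j < k"
      then show ?thesis using no_edge[of j k z y] j step.IH yz by (simp add: insert_commute)
    next
      assume "k < j"
      then show ?thesis using no_edge[of k j y z] j step.IH yz by simp
    qed
    then show ?case using j by simp
  qed
  then have "C \<subseteq> D k" unfolding C connected_component_of_vertex_def by blast
  then show ?thesis using fin by (rule finite_subset)
qed

section \<open>The random graph\<close>

abbreviation fair_coin :: "bool measure" where
  "fair_coin \<equiv> measure_pmf (bernoulli_pmf (1/2))"

interpretation coins: product_prob_space "\<lambda>_. fair_coin" "pairs Npos"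
  by unfold_locales

interpretation edge_coins: prob_space edge_coins
  unfolding edge_coins_def by (rule coins.P.prob_space_axioms)

lemma space_edge_coins: "space edge_coins = PiE (pairs Npos) (\<lambda>_. UNIV)"
  by (simp add: edge_coins_def space_PiM)

lemma measurable_edge_coins_component [measurable]:
  "e \<in> pairs Npos \<Longrightarrow> (\<lambda>\<omega>. \<omega> e) \<in> measurable edge_coins fair_coin"
  unfolding edge_coins_def by (rule measurable_component_singleton)

section \<open>Invariance of the measure under coin flips\<close>

lemma emeasure_fair_coin_flip:
  "emeasure fair_coin ((\<lambda>b. b \<noteq> t) -` B) = emeasure fair_coin B"
proof -
  have "map_pmf Not (bernoulli_pmf (1/2)) = bernoulli_pmf (1/2)"
  proof (rule pmf_eqI)
    show "pmf (map_pmf Not (bernoulli_pmf (1/2))) b = pmf (bernoulli_pmf (1/2)) b" for b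
      using pmf_map_inj'[of Not "bernoulli_pmf (1/2)" "\<not> b"] by (cases b) (auto simp: inj_def)
  qed
  then have "map_pmf (\<lambda>b. b \<noteq> t) (bernoulli_pmf (1/2)) = bernoulli_pmf (1/2)"
    by (cases t) simp_all
  then show ?thesis by (metis emeasure_map_pmf)
qed

lemma measurable_edge_coins_flip:
  "(\<lambda>\<omega>. \<lambda>e\<in>pairs Npos. \<omega> e \<noteq> \<tau> e) \<in> measurable edge_coins edge_coins"
proof -
  have "(\<lambda>\<omega>. \<lambda>e\<in>pairs Npos. \<omega> e \<noteq> \<tau> e) \<in> measurable edge_coins (PiM (pairs Npos) (\<lambda>_. fair_coin))"
  proof (rule measurable_restrict)
    fix e :: "nat set" assume "e \<in> pairs Npos"
    then show "(\<lambda>\<omega>. \<omega> e \<noteq> \<tau> e) \<in> measurable edge_coins fair_coin"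
      by (intro measurable_compose[OF measurable_edge_coins_component, of e "\<lambda>b. b \<noteq> \<tau> e"]) simp_all
  qed
  then show ?thesis by (simp add: edge_coins_def)
qed

text \<open>Product measures are determined on cylinders. The preimage of a cylinder is the cylinder
  with flipped sides, and each fair coin is symmetric; \<open>\<tau>\<close> selects the coins to
  flip.\<close>

lemma distr_edge_coins_flip:
  "distr edge_coins edge_coins (\<lambda>\<omega>. \<lambda>e\<in>pairs Npos. \<omega> e \<noteq> \<tau> e) = edge_coins"
proof -
  let ?f = "\<lambda>\<omega>. \<lambda>e\<in>pairs Npos. \<omega> e \<noteq> \<tau> e"
  have f: "?f \<in> measurable edge_coins edge_coins" by (rule measurable_edge_coins_flip)
  have "distr edge_coins edge_coins ?f = PiM (pairs Npos) (\<lambda>_. fair_coin)"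
  proof (rule coins.PiM_eq)
    show "sets (distr edge_coins edge_coins ?f) = sets (PiM (pairs Npos) (\<lambda>_. fair_coin))"
      by (simp add: edge_coins_def)
    fix J :: "nat set set" and F
    assume J: "finite J" "J \<subseteq> pairs Npos"
    let ?emb = "\<lambda>F. prod_emb (pairs Npos) (\<lambda>_. fair_coin) J (PiE J F)"
    have "emeasure (distr edge_coins edge_coins ?f) (?emb F) =
        emeasure edge_coins (?f -` ?emb F \<inter> space edge_coins)"
      using f J by (intro emeasure_distr) (auto simp: edge_coins_def)
    also have "?f -` ?emb F \<inter> space edge_coins = ?emb (\<lambda>e. (\<lambda>b. b \<noteq> \<tau> e) -` F e)"
      using J(2) by (auto simp: prod_emb_def space_edge_coins PiE_iff extensional_def subset_eq)
    also have "emeasure edge_coins \<dots> = (\<Prod>e\<in>J. emeasure fair_coin ((\<lambda>b. b \<noteq> \<tau> e) -` F e))"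
      using J unfolding edge_coins_def by (intro coins.emeasure_PiM_emb) auto
    also have "\<dots> = (\<Prod>e\<in>J. emeasure fair_coin (F e))"
      by (simp only: emeasure_fair_coin_flip)
    finally show "emeasure (distr edge_coins edge_coins ?f) (?emb F) = \<dots>" .
  qed
  then show ?thesis by (simp add: edge_coins_def)
qed

section \<open>Independence and the zero-one law\<close>

lemma indep_vars_edge_coins:
  "edge_coins.indep_vars (\<lambda>_. fair_coin) (\<lambda>e \<omega>. \<omega> e) (pairs Npos)"
proof (subst edge_coins.indep_vars_iff_distr_eq_PiM')
  have "{1, 2} \<in> pairs Npos" by (auto simp: pairs_def)
  then show "pairs Npos \<noteq> {}" by blast
  have "distr edge_coins (PiM (pairs Npos) (\<lambda>_. fair_coin)) (\<lambda>\<omega>. \<lambda>e\<in>pairs Npos. \<omega> e)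
      = distr edge_coins edge_coins (\<lambda>\<omega>. \<omega>)"
    by (intro distr_cong) (auto simp: edge_coins_def space_PiM)
  also have "\<dots> = PiM (pairs Npos) (\<lambda>e. distr edge_coins fair_coin (\<lambda>\<omega>. \<omega> e))"
    unfolding edge_coins_def distr_id by (intro PiM_cong coins.PiM_component[symmetric] refl)
  finally show "distr edge_coins (PiM (pairs Npos) (\<lambda>_. fair_coin)) (\<lambda>\<omega>. \<lambda>e\<in>pairs Npos. \<omega> e)
      = PiM (pairs Npos) (\<lambda>e. distr edge_coins fair_coin (\<lambda>\<omega>. \<omega> e))" .
qed measurable

text \<open>Kolmogorov's law needs a sequence of independent sigma-algebras, so the edges are
  grouped by their larger endpoint \<open>Max e\<close>. The assumption then says that
  \<open>X\<close> is a tail event for this grouping.\<close>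

lemma edge_coins_zero_one:
  assumes "\<And>n. X \<in> sigma_sets (space edge_coins)
      {{\<omega> \<in> space edge_coins. \<omega> e} | e. e \<in> pairs Npos \<and> n \<le> Max e}"
  shows "edge_coins.prob X = 0 \<or> edge_coins.prob X = 1"
proof -
  let ?E = "\<lambda>e. {(\<lambda>\<omega>. \<omega> e) -` B \<inter> space edge_coins | B. B \<in> sets fair_coin}"
  let ?I = "\<lambda>n::nat. {e \<in> pairs Npos. Max e = n}"
  let ?A = "\<lambda>n. sigma_sets (space edge_coins) (\<Union>e\<in>?I n. ?E e)"
  have "edge_coins.indep_sets ?E (pairs Npos)"
    using indep_vars_edge_coins by (simp add: edge_coins.indep_vars_def2)
  moreover have "(\<Union>n. ?I n) = pairs Npos" by auto
  ultimately have "edge_coins.indep_sets ?E (\<Union>n. ?I n)" by simp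
  then have "edge_coins.indep_sets ?A UNIV"
  proof (rule edge_coins.indep_sets_collect_sigma)
    show "Int_stable (?E e)" for e
      unfolding Int_stable_def
    proof clarify
      fix B B' :: "bool set"
      show "\<exists>B''. (\<lambda>\<omega>. \<omega> e) -` B \<inter> space edge_coins \<inter> ((\<lambda>\<omega>. \<omega> e) -` B' \<inter> space edge_coins) =
        (\<lambda>\<omega>. \<omega> e) -` B'' \<inter> space edge_coins \<and> B'' \<in> sets fair_coin"
        by (rule exI[of _ "B \<inter> B'"]) auto
    qed
    show "disjoint_family_on ?I UNIV" by (auto simp: disjoint_family_on_def)
  qed
  moreover have "sigma_algebra (space edge_coins) (?A n)" for n
    by (intro sigma_algebra_sigma_sets) auto
  moreover have "X \<in> edge_coins.tail_events ?A"
    unfolding edge_coins.tail_events_def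
  proof
    fix n
    have "{\<omega> \<in> space edge_coins. \<omega> e} \<in> (\<Union>(?A ` {n..}))" if "e \<in> pairs Npos" "n \<le> Max e" for e
    proof -
      have "{\<omega> \<in> space edge_coins. \<omega> e} = (\<lambda>\<omega>. \<omega> e) -` {True} \<inter> space edge_coins" by auto
      then have "{\<omega> \<in> space edge_coins. \<omega> e} \<in> ?E e" by auto
      then have "{\<omega> \<in> space edge_coins. \<omega> e} \<in> ?A (Max e)"
        using that(1) by (intro sigma_sets.Basic) blast
      then show ?thesis using that(2) by blast
    qed
    then have "{{\<omega> \<in> space edge_coins. \<omega> e} | e. e \<in> pairs Npos \<and> n \<le> Max e} \<subseteq> (\<Union>(?A ` {n..}))"
      by blast
    then show "X \<in> sigma_sets (space edge_coins) (\<Union>(?A ` {n..}))"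
      using assms[of n] sigma_sets_mono' by blast
  qed
  ultimately show ?thesis by (intro edge_coins.kolmogorov_0_1_law)
qed

section \<open>Adjacency classes over a finite set\<close>

text \<open>For \<open>T \<subseteq> X\<close> these are the vertices outside \<open>X\<close> whose
  neighbours in \<open>X\<close> are exactly \<open>T\<close>; \<open>T = {}\<close> gives the
  vertices without neighbours in \<open>X\<close>. Leaving out \<open>X\<close> keeps every
  \<open>{x, y}\<close> a genuine pair.\<close>

definition adjacency_class :: "(nat set \<Rightarrow> bool) \<Rightarrow> nat set \<Rightarrow> nat set \<Rightarrow> nat set" where
  "adjacency_class \<omega> X T = {y \<in> Npos - X. \<forall>x\<in>X. \<omega> {x, y} \<longleftrightarrow> x \<in> T}"

lemma doubleton_in_pairs: "x \<in> V \<Longrightarrow> y \<in> V \<Longrightarrow> x \<noteq> y \<Longrightarrow> {x, y} \<in> pairs V"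
  by (simp add: pairs_def)

text \<open>Each \<open>\<S> k\<close> is countable, being a set of finite sets of naturals, and
  each inclusion of a finite \<open>D\<close> involves finitely many coins. Removing
  \<open>{..<n}\<close> leaves only coins \<open>{x, y}\<close> with \<open>y \<ge> n\<close>, so
  \<open>Max {x, y} \<ge> n\<close>.\<close>

lemma sigma_sets_adjacency_class:
  assumes fin: "\<And>k D. D \<in> \<S> k \<Longrightarrow> finite D" and X: "finite X" "X \<subseteq> Npos"
  shows "{\<omega> \<in> space edge_coins. \<forall>k::nat. \<exists>D\<in>\<S> k. D \<subseteq> adjacency_class \<omega> X T - {..<n}}
    \<in> sigma_sets (space edge_coins)
      {{\<omega> \<in> space edge_coins. \<omega> e} | e. e \<in> pairs Npos \<and> n \<le> Max e}"
proof -
  let ?G = "{{\<omega> \<in> space edge_coins. \<omega> e} | e. e \<in> pairs Npos \<and> n \<le> Max e}"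
  \<comment> \<open>The sigma-algebra of the late coins is packaged as a measure space so that the
    measurability rules apply to it.\<close>
  define N where "N = sigma (space edge_coins) ?G"
  have G: "?G \<subseteq> Pow (space edge_coins)" by auto
  have space: "space N = space edge_coins" and sets: "sets N = sigma_sets (space edge_coins) ?G"
    unfolding N_def using G by (simp_all add: space_measure_of sets_measure_of)
  have coord: "Measurable.pred N (\<lambda>\<omega>. \<omega> {x, y} \<longleftrightarrow> x \<in> T)"
    if "x \<in> X" "y \<in> Npos - X - {..<n}" for x y
  proof -
    have "{x, y} \<in> pairs Npos" using that X by (intro doubleton_in_pairs) auto
    moreover have "n \<le> Max {x, y}" using that by auto
    ultimately have "{\<omega> \<in> space N. \<omega> {x, y}} \<in> sets N"
      unfolding space sets by (intro sigma_sets.Basic) blast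
    then have [measurable]: "Measurable.pred N (\<lambda>\<omega>. \<omega> {x, y})" by (simp add: pred_def)
    show ?thesis by measurable
  qed
  have cls: "Measurable.pred N (\<lambda>\<omega>. D \<subseteq> adjacency_class \<omega> X T - {..<n})" if "finite D" for D
  \<comment> \<open>If \<open>D\<close> has a point that the class never contains, whatever
    \<open>\<omega>\<close> is, the event is empty.\<close>
  proof (cases "D \<subseteq> Npos - X - {..<n}")
    case True
    then have "(\<lambda>\<omega>. D \<subseteq> adjacency_class \<omega> X T - {..<n}) =
        (\<lambda>\<omega>. \<forall>y\<in>D. \<forall>x\<in>X. \<omega> {x, y} \<longleftrightarrow> x \<in> T)"
      by (auto simp: adjacency_class_def fun_eq_iff)
    then show ?thesis using True coord that X
      by (simp, intro pred_intros_finite) auto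
  next
    case False
    then have "(\<lambda>\<omega>. D \<subseteq> adjacency_class \<omega> X T - {..<n}) = (\<lambda>\<omega>. False)"
      by (auto simp: adjacency_class_def fun_eq_iff)
    then show ?thesis by simp
  qed
  have "countable (\<S> k)" for k
    using fin by (intro countable_subset[OF _ countable_Collect_finite]) auto
  then have "Measurable.pred N (\<lambda>\<omega>. \<forall>k. \<exists>D\<in>\<S> k. D \<subseteq> adjacency_class \<omega> X T - {..<n})"
    using cls fin by (intro pred_intros_countable pred_intros_countable_bounded) auto
  then show ?thesis by (simp add: pred_def space sets)
qed

lemma AE_adjacency_class_empty_in_family:
  assumes F: "furstenberg_family \<F>" "partition_regular \<F>" "Pi02 \<F>"
    and inf: "\<And>A. A \<in> \<F> \<Longrightarrow> infinite A" and X: "finite X" "X \<subseteq> Npos"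
  shows "AE \<omega> in edge_coins. adjacency_class \<omega> X {} \<in> \<F>"
proof -
  obtain \<S> :: "nat \<Rightarrow> nat set set" where fin: "\<And>k D. D \<in> \<S> k \<Longrightarrow> finite D"
    and \<S>: "\<F> = {A \<in> Pow Npos. \<forall>k. \<exists>D\<in>\<S> k. D \<subseteq> A}"
    using Pi02_furstenberg_finite_witnesses F by blast
  have up: "\<And>A B. A \<in> \<F> \<Longrightarrow> A \<subseteq> B \<Longrightarrow> B \<subseteq> Npos \<Longrightarrow> B \<in> \<F>"
    using F(1) unfolding furstenberg_family_def by blast
  define E where "E T = {\<omega> \<in> space edge_coins. adjacency_class \<omega> X T \<in> \<F>}" for T
  have cls_Npos: "adjacency_class \<omega> X T \<subseteq> Npos" for \<omega> T by (auto simp: adjacency_class_def)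
  \<comment> \<open>Since members of \<open>\<F>\<close> are infinite, deleting
    \<open>{..<n}\<close> from the class does not affect membership, so the event depends only on
    late coins, for every \<open>n\<close>.\<close>
  have E_tail: "E T \<in> sigma_sets (space edge_coins)
      {{\<omega> \<in> space edge_coins. \<omega> e} | e. e \<in> pairs Npos \<and> n \<le> Max e}" for T n
  proof -
    have "adjacency_class \<omega> X T \<in> \<F> \<longleftrightarrow> adjacency_class \<omega> X T - {..<n} \<in> \<F>" for \<omega>
      using partition_regular_Diff_finite[OF F(2) inf] up[OF _ _ cls_Npos] by blast
    also have "adjacency_class \<omega> X T - {..<n} \<in> \<F> \<longleftrightarrow>
        (\<forall>k. \<exists>D\<in>\<S> k. D \<subseteq> adjacency_class \<omega> X T - {..<n})" for \<omega>
      using cls_Npos[of \<omega> T] by (subst \<S>) blast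
    finally show ?thesis unfolding E_def using sigma_sets_adjacency_class[OF fin X] by simp
  qed
  have E_sets [measurable]: "E T \<in> sets edge_coins" for T
  proof -
    have "{{\<omega> \<in> space edge_coins. \<omega> e} | e. e \<in> pairs Npos \<and> 0 \<le> Max e} \<subseteq> sets edge_coins"
    proof clarify
      fix e assume "e \<in> pairs Npos"
      then have "(\<lambda>\<omega>. \<omega> e) -` {True} \<inter> space edge_coins \<in> sets edge_coins"
        by (intro measurable_sets[OF measurable_edge_coins_component]) auto
      moreover have "(\<lambda>\<omega>. \<omega> e) -` {True} \<inter> space edge_coins = {\<omega> \<in> space edge_coins. \<omega> e}" by auto
      ultimately show "{\<omega> \<in> space edge_coins. \<omega> e} \<in> sets edge_coins" by simp
    qed
    then show ?thesis using E_tail[of T 0] sets.sigma_sets_subset by blast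
  qed
  have flip: "edge_coins.prob (E T) = edge_coins.prob (E {})" if "T \<subseteq> X" for T
  proof -
    \<comment> \<open>Flip the edges that meet \<open>T\<close>. For \<open>x \<in> X\<close> and
      \<open>y\<close> outside \<open>X\<close>, the edge \<open>{x, y}\<close> meets
      \<open>T\<close> exactly when \<open>x \<in> T\<close>, so class \<open>T\<close> turns into
      class \<open>{}\<close>.\<close>
    let ?f = "\<lambda>\<omega>. \<lambda>e\<in>pairs Npos. \<omega> e \<noteq> (e \<inter> T \<noteq> {})"
    have f: "?f \<in> measurable edge_coins edge_coins" by (rule measurable_edge_coins_flip)
    have "adjacency_class (?f \<omega>) X {} = adjacency_class \<omega> X T" for \<omega>
    proof -
      have "?f \<omega> {x, y} \<longleftrightarrow> (\<omega> {x, y} \<noteq> (x \<in> T))" if "x \<in> X" "y \<in> Npos - X" for x y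
      proof -
        have "{x, y} \<in> pairs Npos" using that X by (intro doubleton_in_pairs) auto
        moreover have "{x, y} \<inter> T \<noteq> {} \<longleftrightarrow> x \<in> T" using that \<open>T \<subseteq> X\<close> by blast
        ultimately show ?thesis by (simp only: restrict_apply' not_not)
      qed
      then show ?thesis unfolding adjacency_class_def by blast
    qed
    then have "?f -` E {} \<inter> space edge_coins = E T"
      using measurable_space[OF f] by (auto simp: E_def)
    then have "edge_coins.prob (E T) = measure (distr edge_coins edge_coins ?f) (E {})"
      using measure_distr[OF f E_sets] by simp
    then show ?thesis by (simp only: distr_edge_coins_flip)
  qed
  have "space edge_coins \<subseteq> (\<Union>T\<in>Pow X. E T)"
  proof
    fix \<omega> assume \<omega>: "\<omega> \<in> space edge_coins"
    have "(\<Union>T\<in>Pow X. adjacency_class \<omega> X T) = Npos - X"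
    proof
      show "(\<Union>T\<in>Pow X. adjacency_class \<omega> X T) \<subseteq> Npos - X"
        unfolding adjacency_class_def by blast
      show "Npos - X \<subseteq> (\<Union>T\<in>Pow X. adjacency_class \<omega> X T)"
      proof
        fix y assume "y \<in> Npos - X"
        then have "y \<in> adjacency_class \<omega> X {x \<in> X. \<omega> {x, y}}"
          by (simp add: adjacency_class_def)
        moreover have "{x \<in> X. \<omega> {x, y}} \<in> Pow X" by blast
        ultimately show "y \<in> (\<Union>T\<in>Pow X. adjacency_class \<omega> X T)" by (rule UN_I[rotated])
      qed
    qed
    moreover have "Npos - X \<in> \<F>"
    proof -
      have "\<F> \<noteq> {}" "\<F> \<subseteq> Pow Npos" using F(1) by (simp_all add: furstenberg_family_def)
      then obtain A where "A \<in> \<F>" "A \<subseteq> Npos" by auto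
      then have "Npos \<in> \<F>" by (rule up) simp
      then show ?thesis by (intro partition_regular_Diff_finite F(2) inf X(1))
    qed
    ultimately have "\<exists>T\<in>Pow X. adjacency_class \<omega> X T \<in> \<F>"
      using partition_regular_finite_UN[OF F(2), of "Pow X" "adjacency_class \<omega> X"] X
      by (simp only: finite_Pow_iff Pow_not_empty simp_thms)
    then show "\<omega> \<in> (\<Union>T\<in>Pow X. E T)" using \<omega> by (auto simp: E_def)
  qed
  \<comment> \<open>The events \<open>E T\<close> cover the space and are equally likely, so the
    union bound over the finitely many \<open>T\<close> rules out probability 0.\<close>
  then have "edge_coins.prob (space edge_coins) \<le> edge_coins.prob (\<Union>T\<in>Pow X. E T)"
    using X by (intro edge_coins.finite_measure_mono) auto
  also have "\<dots> \<le> (\<Sum>T\<in>Pow X. edge_coins.prob (E T))"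
    using X by (intro measure_UNION_le) auto
  also have "\<dots> = (\<Sum>T\<in>Pow X. edge_coins.prob (E {}))"
    by (intro sum.cong) (auto intro: flip)
  finally have "edge_coins.prob (E {}) \<noteq> 0"
    by (auto simp: edge_coins.prob_space)
  then have "edge_coins.prob (E {}) = 1"
    using edge_coins_zero_one[of "E {}", OF E_tail] by blast
  then have "AE \<omega> in edge_coins. \<omega> \<in> E {}"
    by (subst (asm) edge_coins.prob_eq_1) auto
  then show ?thesis by (rule AE_mp) (auto simp: E_def)
qed

section \<open>Greedy construction and conclusion\<close>

lemma finite_components_if_empty_classes_in_family:
  assumes F: "furstenberg_family \<F>" "Pi02 \<F>"
    and cls: "\<And>X. finite X \<Longrightarrow> X \<subseteq> Npos \<Longrightarrow> adjacency_class \<omega> X {} \<in> \<F>"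
  shows "\<exists>A\<in>\<F>. \<forall>C\<in>connected_components (induced (coin_graph \<omega>) A). finite C"
proof -
  obtain \<S> :: "nat \<Rightarrow> nat set set" where fin: "\<And>k D. D \<in> \<S> k \<Longrightarrow> finite D"
    and \<S>: "\<F> = {A \<in> Pow Npos. \<forall>k. \<exists>D\<in>\<S> k. D \<subseteq> A}"
    using Pi02_furstenberg_finite_witnesses F by blast
  have "\<exists>D\<in>\<S> k. D \<subseteq> adjacency_class \<omega> X {}" if "finite X \<and> X \<subseteq> Npos" for k X
    using cls[of X] that \<S> by blast
  then have "\<forall>k X. \<exists>D. finite X \<and> X \<subseteq> Npos \<longrightarrow> D \<in> \<S> k \<and> D \<subseteq> adjacency_class \<omega> X {}"
    by blast
  then obtain d where d: "\<And>k X. finite X \<and> X \<subseteq> Npos \<Longrightarrow>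
      d k X \<in> \<S> k \<and> d k X \<subseteq> adjacency_class \<omega> X {}"
    by metis
  \<comment> \<open>\<open>Z k\<close> collects what was chosen before stage \<open>k\<close>. It
    stays finite because members of \<open>\<S> k\<close> are finite, so the next choice can again
    be made among vertices outside \<open>Z k\<close> without neighbours in it.\<close>
  define Z where "Z = rec_nat {} (\<lambda>k X. X \<union> d k X)"
  have Z_Suc: "Z (Suc k) = Z k \<union> d k (Z k)" for k by (simp add: Z_def)
  have Z: "finite (Z k) \<and> Z k \<subseteq> Npos" for k
  proof (induction k)
    case 0
    then show ?case by (simp add: Z_def)
  next
    case (Suc k)
    then show ?case using d[OF Suc, of k] fin unfolding Z_Suc
      by (auto simp: adjacency_class_def)
  qed
  define D where "D k = d k (Z k)" for k
  have D: "D k \<in> \<S> k" "D k \<subseteq> adjacency_class \<omega> (Z k) {}" for k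
    using d[OF Z] by (auto simp: D_def)
  have D_Z: "D j \<subseteq> Z k" if "j < k" for j k
    using that by (induction k) (auto simp: Z_Suc D_def less_Suc_eq)
  have "(\<Union>k. D k) \<subseteq> Npos" using D(2) by (fastforce simp: adjacency_class_def)
  moreover have "\<forall>k. \<exists>D'\<in>\<S> k. D' \<subseteq> (\<Union>k. D k)" using D(1) by blast
  ultimately have "(\<Union>k. D k) \<in> \<F>" using \<S> by blast
  moreover have "finite C" if "C \<in> connected_components (induced (coin_graph \<omega>) (\<Union>k. D k))" for C
  proof (rule finite_components_if_no_cross_edges[OF _ _ _ that])
    show "finite (D k)" for k using D(1) fin by blast
    fix j k :: nat assume "j < k"
    then have jk: "D j \<subseteq> Z k" by (rule D_Z)
    show "D j \<inter> D k = {}" using jk D(2)[of k] by (auto simp: adjacency_class_def)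
    show "{x, y} \<notin> edges (coin_graph \<omega>)" if "x \<in> D j" "y \<in> D k" for x y
      using that jk D(2)[of k] by (auto simp: adjacency_class_def coin_graph_def)
  qed
  ultimately show ?thesis by blast
qed

text \<open>A finite member of \<open>\<F>\<close> has only finite components in any graph.
  Otherwise there are only countably many finite \<open>X\<close>, so their exceptional null sets
  can be discarded together.\<close>

lemma AE_finite_components:
  assumes F: "furstenberg_family \<F>" "partition_regular \<F>" "Pi02 \<F>"
  shows "AE \<omega> in edge_coins.
    \<exists>A\<in>\<F>. \<forall>C\<in>connected_components (induced (coin_graph \<omega>) A). finite C"
proof (cases "\<exists>A\<in>\<F>. finite A")
  case True
  then obtain A where "A \<in> \<F>" "finite A" by blast
  moreover have "finite C" if "C \<in> connected_components (induced G A)" for C and G :: "nat ugraph"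
    using that \<open>finite A\<close>
    by (auto simp: connected_components_def connected_component_of_vertex_def induced_def)
  ultimately show ?thesis by blast
next
  case False
  have "countable {X. finite X \<and> X \<subseteq> Npos}"
    by (rule countable_subset[OF _ countable_Collect_finite]) auto
  then have "AE \<omega> in edge_coins. \<forall>X\<in>{X. finite X \<and> X \<subseteq> Npos}. adjacency_class \<omega> X {} \<in> \<F>"
    using False by (subst AE_ball_countable)
      (auto intro!: AE_adjacency_class_empty_in_family F)
  then show ?thesis
    by (rule AE_mp) (intro AE_I2 impI finite_components_if_empty_classes_in_family F, blast)
qed

theorem theorem4:
  fixes \<F> :: "nat set set"
  assumes "furstenberg_family \<F>" and "partition_regular \<F>" and "Pi02 \<F>"
  shows "almost_every_graph (\<lambda>G.
           (\<exists>A\<in>\<F>. \<forall>C\<in>connected_components (induced G A). finite C) \<and>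
           \<not> (\<forall>A\<in>\<F>. universal G A))"
  unfolding almost_every_graph_def
  using AE_finite_components[OF assms]
  by (rule AE_mp) (use finite_component_not_universal in blast)

end
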